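(* Let $(X^{(n)})_{n\ge 1}$ be a sequence of reversible and irreducible continuous time Markov chains with state spaces $S^{(n)}$. Then the following two conditions are equivalent. (A) There exists a nondegenerate sequence of Boolean functions $(f_n)_{n\ge1}$, $f_n\colon S^{(n)}\to\{0,1\}$, which is noise stable with respect to $(X^{(n)})_{n\ge1}$. (B) There are $\varepsilon>0$, $k>0$ and a sequence $(\psi^{(n)})_{n\ge1}$ with $\psi^{(n)}\in\Psi_k^{(n)}$ and $\langle\psi^{(n)},\psi^{(n)}\rangle=1$, such that $$P_w\bigl(\psi^{(n)}(w)^2<\varepsilon\bigr)<1-\varepsilon$$ for all large enough $n$.
   Context: Each $X^{(n)}=(X^{(n)}_t)_{t\ge0}$ has a finite state space $S^{(n)}$ with $|S^{(n)}|\ge2$, generator $Q_n$ and stationary distribution $\pi_n$; $X_0^{(n)}$ is always distributed according to $\pi_n$, and $P_w$ denotes probability when $w\in S^{(n)}$ is distributed according to $\pi_n$. For $f,g\colon S^{(n)}\to\mathbb R$, $\langle f,g\rangle=\sum_{w\in S^{(n)}}\pi_n(w)f(w)g(w)$. Let $0=\lambda_0^{(n)}<\lambda_1^{(n)}\le\dots\le\lambda^{(n)}_{|S^{(n)}|-1}$ be the eigenvalues of $-Q_n$, with corresponding eigenvectors $\psi_0^{(n)}\equiv1,\psi_1^{(n)},\dots$ forming an orthonormal basis with respect to $\langle\cdot,\cdot\rangle$. Put $\Psi_k^{(n)}=\operatorname{Span}\bigl(\{\psi_i^{(n)}\colon\lambda_1^{(n)}\le\lambda_i^{(n)}\le k\lambda_1^{(n)}\}\bigr)$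 and $t_{rel}^{(n)}=1/\lambda_1^{(n)}$. A sequence $(f_n)_{n\ge1}$ of Boolean functions $f_n\colon S^{(n)}\to\{0,1\}$ is nondegenerate if $\liminf_{n\to\infty}\operatorname{Var}(f_n)>0$, where $\operatorname{Var}(f_n)$ is the variance of $f_n(w)$ for $w\sim\pi_n$. It is noise stable with respect to $(X^{(n)})_{n\ge1}$ if $\lim_{\alpha\to0^+}\sup_n P\bigl(f_n(X_0^{(n)})\ne f_n(X^{(n)}_{\alpha t_{rel}^{(n)}})\bigr)=0$. *)

theory Defs
  imports "HOL-Probability.Probability"
begin

definition is_generator :: "'a set \<Rightarrow> ('a \<Rightarrow> 'a \<Rightarrow> real) \<Rightarrow> bool" where
  "is_generator S Q \<longleftrightarrow>
     (\<forall>x\<in>S. \<forall>y\<in>S. x \<noteq> y \<longrightarrow> 0 \<le> Q x y) \<and> (\<forall>x\<in>S. (\<Sum>y\<in>S. Q x y) = 0)"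

primrec gen_power :: "'a set \<Rightarrow> ('a \<Rightarrow> 'a \<Rightarrow> real) \<Rightarrow> nat \<Rightarrow> 'a \<Rightarrow> 'a \<Rightarrow> real" where
  "gen_power S Q 0 x y = of_bool (x = y)"
| "gen_power S Q (Suc j) x y = (\<Sum>z\<in>S. Q x z * gen_power S Q j z y)"

text \<open>The entry at \<open>(x, y)\<close> of the matrix exponential \<open>exp (t Q)\<close>; for finite \<open>S\<close> the series
  converges absolutely.\<close>

definition transition :: "'a set \<Rightarrow> ('a \<Rightarrow> 'a \<Rightarrow> real) \<Rightarrow> real \<Rightarrow> 'a \<Rightarrow> 'a \<Rightarrow> real" where
  "transition S Q t x y = (\<Sum>j. t ^ j / fact j * gen_power S Q j x y)"

definition stationary_distribution :: "'a set \<Rightarrow> ('a \<Rightarrow> 'a \<Rightarrow> real) \<Rightarrow> 'a pmf \<Rightarrow> bool" where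
  "stationary_distribution S Q \<pi> \<longleftrightarrow>
     set_pmf \<pi> \<subseteq> S \<and> (\<forall>y\<in>S. (\<Sum>x\<in>S. pmf \<pi> x * Q x y) = 0)"

text \<open>A process \<open>X\<close>, indexed by times \<open>t \<ge> 0\<close>, on the probability space \<open>M\<close>. Path regularity is not
  required, as only finite-dimensional distributions matter here. The guard on the conditioning
  event is needed because \<open>cond_prob\<close> is \<open>0\<close> when conditioning on a null event.\<close>

definition markov_chain ::
  "'w measure \<Rightarrow> 'a set \<Rightarrow> ('a \<Rightarrow> 'a \<Rightarrow> real) \<Rightarrow> 'a pmf \<Rightarrow> (real \<Rightarrow> 'w \<Rightarrow> 'a) \<Rightarrow> bool" where
  "markov_chain M S Q \<mu> X \<longleftrightarrow>
     prob_space M \<and> is_generator S Q \<and>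
     (\<forall>t\<ge>0. X t \<in> measurable M (count_space S)) \<and>
     (\<forall>x\<in>S. measure M {\<omega> \<in> space M. X 0 \<omega> = x} = pmf \<mu> x) \<and>
     (\<forall>m t x. 0 \<le> t 0 \<and> (\<forall>i\<le>m. t i < t (Suc i)) \<and> (\<forall>i\<le>Suc m. x i \<in> S) \<and>
        0 < measure M {\<omega> \<in> space M. \<forall>i\<le>m. X (t i) \<omega> = x i} \<longrightarrow>
        cond_prob M (\<lambda>\<omega>. X (t (Suc m)) \<omega> = x (Suc m)) (\<lambda>\<omega>. \<forall>i\<le>m. X (t i) \<omega> = x i)
          = transition S Q (t (Suc m) - t m) (x m) (x (Suc m)))"

definition reversible :: "'a set \<Rightarrow> ('a \<Rightarrow> 'a \<Rightarrow> real) \<Rightarrow> 'a pmf \<Rightarrow> bool" where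
  "reversible S Q \<pi> \<longleftrightarrow> (\<forall>x\<in>S. \<forall>y\<in>S. pmf \<pi> x * Q x y = pmf \<pi> y * Q y x)"

definition irreducible_generator :: "'a set \<Rightarrow> ('a \<Rightarrow> 'a \<Rightarrow> real) \<Rightarrow> bool" where
  "irreducible_generator S Q \<longleftrightarrow>
     (\<forall>x\<in>S. \<forall>y\<in>S. (x, y) \<in> {(u, v). u \<in> S \<and> v \<in> S \<and> u \<noteq> v \<and> 0 < Q u v}\<^sup>*)"

definition inner_pi :: "'a set \<Rightarrow> 'a pmf \<Rightarrow> ('a \<Rightarrow> real) \<Rightarrow> ('a \<Rightarrow> real) \<Rightarrow> real" where
  "inner_pi S \<pi> f g = (\<Sum>w\<in>S. pmf \<pi> w * f w * g w)"

text \<open>Functions on \<open>S\<close> are represented by functions on the ambient type; only their values on \<open>S\<close>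
  matter. The indices \<open>i < card S\<close> list the eigenvalues of \<open>-Q\<close> with multiplicity.\<close>

definition spectral_basis ::
  "'a set \<Rightarrow> ('a \<Rightarrow> 'a \<Rightarrow> real) \<Rightarrow> 'a pmf \<Rightarrow> (nat \<Rightarrow> real) \<Rightarrow> (nat \<Rightarrow> 'a \<Rightarrow> real) \<Rightarrow> bool" where
  "spectral_basis S Q \<pi> lam \<psi> \<longleftrightarrow>
     lam 0 = 0 \<and> 0 < lam 1 \<and> (\<forall>i j. i \<le> j \<and> j < card S \<longrightarrow> lam i \<le> lam j) \<and>
     (\<forall>w\<in>S. \<psi> 0 w = 1) \<and>
     (\<forall>i<card S. \<forall>x\<in>S. - (\<Sum>y\<in>S. Q x y * \<psi> i y) = lam i * \<psi> i x) \<and>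
     (\<forall>i<card S. \<forall>j<card S. inner_pi S \<pi> (\<psi> i) (\<psi> j) = of_bool (i = j)) \<and>
     (\<forall>g. \<exists>c. \<forall>w\<in>S. g w = (\<Sum>i<card S. c i * \<psi> i w))"

definition low_span ::
  "'a set \<Rightarrow> (nat \<Rightarrow> real) \<Rightarrow> (nat \<Rightarrow> 'a \<Rightarrow> real) \<Rightarrow> real \<Rightarrow> ('a \<Rightarrow> real) set" where
  "low_span S lam \<psi> k =
     {g. \<exists>c. \<forall>w\<in>S. g w =
        (\<Sum>i | i < card S \<and> lam 1 \<le> lam i \<and> lam i \<le> k * lam 1. c i * \<psi> i w)}"

definition relaxation_time :: "(nat \<Rightarrow> real) \<Rightarrow> real" where
  "relaxation_time lam = 1 / lam 1"

definition boolean_functions :: "(nat \<Rightarrow> 'a set) \<Rightarrow> (nat \<Rightarrow> 'a \<Rightarrow> real) \<Rightarrow> bool" where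
  "boolean_functions S f \<longleftrightarrow> (\<forall>n\<ge>1. f n \<in> S n \<rightarrow> {0, 1})"

definition nondegenerate :: "(nat \<Rightarrow> 'a pmf) \<Rightarrow> (nat \<Rightarrow> 'a \<Rightarrow> real) \<Rightarrow> bool" where
  "nondegenerate \<pi> f \<longleftrightarrow> 0 < liminf (\<lambda>n. ereal (measure_pmf.variance (\<pi> n) (f n)))"

definition noise_stable ::
  "(nat \<Rightarrow> 'w measure) \<Rightarrow> (nat \<Rightarrow> real \<Rightarrow> 'w \<Rightarrow> 'a) \<Rightarrow> (nat \<Rightarrow> real) \<Rightarrow> (nat \<Rightarrow> 'a \<Rightarrow> real) \<Rightarrow> bool"
  where
  "noise_stable M X t_rel f \<longleftrightarrow>
     ((\<lambda>\<alpha>. SUP n\<in>{1..}. measure (M n)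
          {\<omega> \<in> space (M n). f n (X n 0 \<omega>) \<noteq> f n (X n (\<alpha> * t_rel n) \<omega>)})
        \<longlongrightarrow> 0) (at_right 0)"

end

theory Submission
  imports Defs
begin

text \<open>
  Reversibility diagonalises the joint law of \<open>X 0\<close> and \<open>X t\<close>: with \<open>c i\<close> the coefficients of \<open>g\<close> in
  the eigenbasis, the expectation of \<open>(g (X 0) - g (X t))\<^sup>2\<close> is
  \<open>2 * (\<Sum>i. (c i)\<^sup>2 * (1 - exp (- lam i * t)))\<close> (\<open>increment_energy\<close>). For a Boolean function this
  expectation is the probability that its value changes, so noise stability says that
  the energy of \<open>f\<close> above frequency \<open>k * lam 1\<close> is small, uniformly in the chain, for \<open>k\<close> large.

  Hence a stable nondegenerate \<open>f\<close> is, up to a small \<open>L\<^sup>2\<close> error, its mean plus a combination \<open>g\<close> of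
  low frequency eigenvectors. As \<open>f\<close> minus its mean is bounded away from \<open>0\<close> everywhere,
  Chebyshev's inequality keeps \<open>g\<close> away from \<open>0\<close> with probability at least one half, and
  normalising \<open>g\<close> gives the function wanted (\<open>low_frequency_part_of_stable_function\<close>).

  Conversely, a normalised low frequency function \<open>\<phi>\<close> moves little: the expectation of
  \<open>\<bar>\<phi> (X 0) - \<phi> (X t)\<bar>\<close> is at most \<open>sqrt (2 * k * \<alpha>)\<close> for \<open>t\<close> equal to \<open>\<alpha>\<close> relaxation times
  (\<open>low_span_increment\<close>). This expectation is also the integral over all levels \<open>a\<close> of the noise of the
  level set \<open>{\<phi> > a}\<close> (\<open>level_noise_integral\<close>), so a typical level gives a stable set. One level has to
  serve all times at once; the geometric sequence \<open>\<alpha> = (1/16) ^ j\<close> suffices because the noise of a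
  Boolean function increases with time, and along it the exceptional sets of levels
  have summable measures (\<open>exists_point_good_at_all_scales\<close>). Nondegeneracy holds for every level in
  an interval: \<open>\<phi>\<close> has mean \<open>0\<close> and the spread hypothesis bounds the mean of \<open>\<bar>\<phi>\<bar>\<close> from below, so
  the positive and the negative part both have substantial mean, which by Cauchy-Schwarz needs
  substantial probability (\<open>variance_level_set_ge\<close>).
\<close>

section \<open>Choosing a level that is good at all scales\<close>

lemma weighted_abs_sum_le_sqrt:
  fixes p d :: "'i \<Rightarrow> real"
  assumes "\<And>i. i \<in> I \<Longrightarrow> 0 \<le> p i" "sum p I \<le> 1"
  shows "(\<Sum>i\<in>I. p i * \<bar>d i\<bar>) \<le> sqrt (\<Sum>i\<in>I. p i * (d i)\<^sup>2)"
proof -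
  have "(\<Sum>i\<in>I. p i * \<bar>d i\<bar>) = (\<Sum>i\<in>I. sqrt (p i) * (sqrt (p i) * \<bar>d i\<bar>))"
    by (intro sum.cong refl) (simp add: assms flip: mult.assoc)
  also have "(\<dots>)\<^sup>2 \<le> (\<Sum>i\<in>I. (sqrt (p i))\<^sup>2) * (\<Sum>i\<in>I. (sqrt (p i) * \<bar>d i\<bar>)\<^sup>2)"
    by (rule Cauchy_Schwarz_ineq_sum)
  also have "\<dots> = sum p I * (\<Sum>i\<in>I. p i * (d i)\<^sup>2)"
    by (intro arg_cong2[where f="(*)"] sum.cong refl) (simp_all add: assms power_mult_distrib)
  also have "\<dots> \<le> 1 * (\<Sum>i\<in>I. p i * (d i)\<^sup>2)"
    by (intro mult_right_mono sum_nonneg) (simp_all add: assms)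
  finally show ?thesis
    by (intro real_le_rsqrt) simp
qed

text \<open>
  Markov's inequality bounds the measure of the points that are bad at scale \<open>j\<close> by \<open>h / 4 * (1/2) ^ j\<close>,
  and these bounds add up to less than \<open>h\<close>. The proof integrates the weighted series
  \<open>\<Sum>j. 2 ^ j * p j a\<close> instead of the union of the bad sets: if every point of the interval were bad,
  the series would be at least \<open>4 * D / h\<close> there, against a total integral of at most \<open>2 * D\<close>.
\<close>

lemma exists_point_good_at_all_scales:
  fixes p :: "nat \<Rightarrow> real \<Rightarrow> real"
  assumes meas: "\<And>j. p j \<in> borel_measurable borel"
    and int: "\<And>j. (\<integral>\<^sup>+a. ennreal (p j a) \<partial>lborel) \<le> ennreal (D * (1/4)^j)"
    and "0 < D" "0 < h"
  shows "\<exists>a\<in>{0..h}. \<forall>j. p j a \<le> 4 * D / h * (1/2)^j"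
proof (rule ccontr)
  assume "\<not> ?thesis"
  then have bad: "\<exists>j. 4 * D / h * (1/2)^j < p j a" if "a \<in> {0..h}" for a
    using that unfolding not_le[symmetric] by blast
  have "ennreal (4 * D) = (\<integral>\<^sup>+a. ennreal (4 * D / h) * indicator {0..h} a \<partial>lborel)"
    using assms(3,4) by (simp add: nn_integral_cmult_indicator flip: ennreal_mult)
  also have "\<dots> \<le> (\<integral>\<^sup>+a. (\<Sum>j. ennreal (2^j) * ennreal (p j a)) \<partial>lborel)"
  proof (intro nn_integral_mono)
    fix a :: real
    show "ennreal (4 * D / h) * indicator {0..h} a \<le> (\<Sum>j. ennreal (2^j) * ennreal (p j a))"
    proof (cases "a \<in> {0..h}")
      case True
      then obtain j where j: "4 * D / h * (1/2)^j < p j a"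
        using bad by blast
      then have "4 * D / h \<le> 2^j * p j a"
        using assms(4) by (simp add: divide_simps power_one_over) (simp add: mult_ac)
      then have "ennreal (4 * D / h) \<le> ennreal (2^j) * ennreal (p j a)"
        by (simp add: ennreal_leI flip: ennreal_mult')
      also have "\<dots> \<le> (\<Sum>j. ennreal (2^j) * ennreal (p j a))"
        using sum_le_suminf[of "\<lambda>j. ennreal (2^j) * ennreal (p j a)" "{j}"] by simp
      finally show ?thesis
        using True by simp
    qed simp
  qed
  also have "\<dots> = (\<Sum>j. \<integral>\<^sup>+a. ennreal (2^j) * ennreal (p j a) \<partial>lborel)"
    using meas by (intro nn_integral_suminf) simp
  also have "\<dots> = (\<Sum>j. ennreal (2^j) * (\<integral>\<^sup>+a. ennreal (p j a) \<partial>lborel))"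
    using meas by (intro suminf_cong nn_integral_cmult) simp
  also have "\<dots> \<le> (\<Sum>j. ennreal (D * (1/2)^j))"
  proof (intro suminf_le summableI)
    fix j
    have "ennreal (2^j) * (\<integral>\<^sup>+a. ennreal (p j a) \<partial>lborel) \<le> ennreal (2^j) * ennreal (D * (1/4)^j)"
      using int by (intro mult_left_mono) simp_all
    also have "\<dots> = ennreal (D * (2^j * (1/4)^j))"
      by (simp add: mult.left_commute flip: ennreal_mult')
    also have "(2::real)^j * (1/4)^j = (1/2)^j"
      by (simp flip: power_mult_distrib)
    finally show "ennreal (2^j) * (\<integral>\<^sup>+a. ennreal (p j a) \<partial>lborel) \<le> ennreal (D * (1/2)^j)" .
  qed
  also have "\<dots> = ennreal (2 * D)"
  proof (intro suminf_ennreal_eq)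
    have "(\<lambda>j. (1/2::real)^j) sums 2"
      using geometric_sums[of "1/2::real"] by simp
    then show "(\<lambda>j. D * (1/2)^j) sums (2 * D)"
      by (metis mult.commute sums_mult)
  qed (use assms(3) in simp)
  finally show False
    using assms(3) by (simp add: ennreal_le_iff)
qed

lemma nn_integral_separating_level:
  fixes b c :: real
  shows "(\<integral>\<^sup>+a. ennreal (of_bool ((a < b) \<noteq> (a < c))) \<partial>lborel) = ennreal \<bar>b - c\<bar>"
proof -
  have "(\<integral>\<^sup>+a. ennreal (of_bool ((a < b) \<noteq> (a < c))) \<partial>lborel)
      = (\<integral>\<^sup>+a. indicator {min b c..<max b c} a \<partial>lborel)"
    by (intro nn_integral_cong) (auto simp: indicator_def)
  then show ?thesis
    by (simp add: min_def max_def)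
qed

section \<open>The joint law of the chain at two times\<close>

text \<open>
  The locale fixes a single chain of the sequence. The bounds proved in it do not involve the chain
  itself, which makes them uniform along the sequence.
\<close>

locale spectral_chain =
  fixes M :: "'w measure" and S :: "'a set" and Q :: "'a \<Rightarrow> 'a \<Rightarrow> real" and \<pi> :: "'a pmf"
    and X :: "real \<Rightarrow> 'w \<Rightarrow> 'a" and lam :: "nat \<Rightarrow> real" and \<psi> :: "nat \<Rightarrow> 'a \<Rightarrow> real"
  assumes finite_S: "finite S"
    and card_S: "2 \<le> card S"
    and stationary: "stationary_distribution S Q \<pi>"
    and chain: "markov_chain M S Q \<pi> X"
    and basis: "spectral_basis S Q \<pi> lam \<psi>"
begin

definition mean :: "('a \<Rightarrow> real) \<Rightarrow> real" where
  "mean g = (\<Sum>w\<in>S. pmf \<pi> w * g w)"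

definition coeff :: "('a \<Rightarrow> real) \<Rightarrow> nat \<Rightarrow> real" where
  "coeff g i = inner_pi S \<pi> g (\<psi> i)"

definition joint :: "real \<Rightarrow> 'a \<Rightarrow> 'a \<Rightarrow> real" where
  "joint t x y = measure M {\<omega> \<in> space M. X 0 \<omega> = x \<and> X t \<omega> = y}"

definition noise :: "('a \<Rightarrow> real) \<Rightarrow> real \<Rightarrow> real" where
  "noise f t = measure M {\<omega> \<in> space M. f (X 0 \<omega>) \<noteq> f (X t \<omega>)}"

lemma lam_0: "lam 0 = 0" and lam_1: "0 < lam 1"
  and lam_mono: "i \<le> j \<Longrightarrow> j < card S \<Longrightarrow> lam i \<le> lam j"
  and psi_0: "w \<in> S \<Longrightarrow> \<psi> 0 w = 1"
  and eigen: "i < card S \<Longrightarrow> x \<in> S \<Longrightarrow> (\<Sum>y\<in>S. Q x y * \<psi> i y) = - lam i * \<psi> i x"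
  and orthonormal: "i < card S \<Longrightarrow> j < card S \<Longrightarrow> inner_pi S \<pi> (\<psi> i) (\<psi> j) = of_bool (i = j)"
  and spanning: "\<exists>c. \<forall>w\<in>S. g w = (\<Sum>i<card S. c i * \<psi> i w)"
  using basis unfolding spectral_basis_def by (fastforce simp: minus_equation_iff)+

lemma prob_space_M: "prob_space M"
  using chain by (simp add: markov_chain_def)

lemma X_measurable [measurable]: "0 \<le> t \<Longrightarrow> X t \<in> measurable M (count_space S)"
  using chain by (simp add: markov_chain_def)

lemma set_pmf_subset: "set_pmf \<pi> \<subseteq> S"
  using stationary by (simp add: stationary_distribution_def)

lemma sum_pmf: "(\<Sum>w\<in>S. pmf \<pi> w) = 1"
  using sum_pmf_eq_1 finite_S set_pmf_subset by blast

lemma lam_nonneg: "i < card S \<Longrightarrow> 0 \<le> lam i"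
  using lam_mono[of 0 i] lam_0 by simp

lemma lam_1_le_iff: "i < card S \<Longrightarrow> lam 1 \<le> lam i \<longleftrightarrow> i \<noteq> 0"
  using lam_mono[of 1 i] lam_0 lam_1 by (cases i) auto

lemma coeff_expansion:
  assumes g: "\<And>w. w \<in> S \<Longrightarrow> g w = (\<Sum>i\<in>I. c i * \<psi> i w)"
    and I: "I \<subseteq> {..<card S}" and j: "j < card S"
  shows "coeff g j = (if j \<in> I then c j else 0)"
proof -
  have fin: "finite I"
    using I finite_subset by blast
  have "coeff g j = (\<Sum>w\<in>S. \<Sum>i\<in>I. c i * (pmf \<pi> w * \<psi> i w * \<psi> j w))"
    unfolding coeff_def inner_pi_def
    by (intro sum.cong refl) (simp add: g sum_distrib_left sum_distrib_right mult_ac)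
  also have "\<dots> = (\<Sum>i\<in>I. c i * inner_pi S \<pi> (\<psi> i) (\<psi> j))"
    unfolding inner_pi_def by (subst sum.swap) (simp add: sum_distrib_left)
  also have "\<dots> = (\<Sum>i\<in>I. if i = j then c i else 0)"
    using I j by (intro sum.cong refl) (auto simp: orthonormal)
  finally show ?thesis
    using fin by simp
qed

lemma expansion:
  assumes "w \<in> S"
  shows "g w = (\<Sum>i<card S. coeff g i * \<psi> i w)"
proof -
  obtain c where c: "\<And>w. w \<in> S \<Longrightarrow> g w = (\<Sum>i<card S. c i * \<psi> i w)"
    using spanning by blast
  show ?thesis
    unfolding c[OF assms] by (intro sum.cong refl) (simp add: coeff_expansion[OF c])
qed

lemma parseval: "inner_pi S \<pi> g g = (\<Sum>i<card S. (coeff g i)\<^sup>2)"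
proof -
  have "inner_pi S \<pi> g g = (\<Sum>w\<in>S. pmf \<pi> w * g w * (\<Sum>i<card S. coeff g i * \<psi> i w))"
    unfolding inner_pi_def by (intro sum.cong refl) (simp flip: expansion)
  also have "\<dots> = (\<Sum>i<card S. coeff g i * inner_pi S \<pi> g (\<psi> i))"
    unfolding inner_pi_def
    by (simp add: sum_distrib_left mult_ac) (subst sum.swap, rule refl)
  finally show ?thesis
    by (simp add: coeff_def power2_eq_square)
qed

lemma coeff_0: "coeff g 0 = mean g"
  unfolding coeff_def mean_def inner_pi_def by (intro sum.cong refl) (simp add: psi_0)

lemma mean_psi: "i < card S \<Longrightarrow> mean (\<psi> i) = of_bool (i = 0)"
  using orthonormal[of i 0] card_S unfolding coeff_0[symmetric] coeff_def by fastforce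

lemma gen_power_eigen:
  assumes "i < card S" "x \<in> S"
  shows "(\<Sum>y\<in>S. gen_power S Q j x y * \<psi> i y) = (- lam i)^j * \<psi> i x"
  using assms(2)
proof (induction j arbitrary: x)
  case 0
  then show ?case
    using finite_S by (simp add: of_bool_def if_distrib[of "\<lambda>u. u * _"] cong: if_cong)
next
  case (Suc j)
  have "(\<Sum>y\<in>S. gen_power S Q (Suc j) x y * \<psi> i y)
      = (\<Sum>z\<in>S. Q x z * (\<Sum>y\<in>S. gen_power S Q j z y * \<psi> i y))"
    by (simp add: sum_distrib_left sum_distrib_right mult_ac) (subst sum.swap, rule refl)
  also have "\<dots> = (- lam i)^j * (\<Sum>z\<in>S. Q x z * \<psi> i z)"
    unfolding sum_distrib_left[of "(- lam i)^j"] by (intro sum.cong refl) (simp add: Suc.IH)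
  finally show ?case
    using Suc.prems assms(1) by (simp add: eigen)
qed

text \<open>
  Expanding the indicator of \<open>y\<close> in the eigenbasis writes each matrix power as a finite sum of
  powers of eigenvalues, so that the exponential series of the matrix reduces to scalar ones.
\<close>

lemma transition_spectral:
  assumes x: "x \<in> S" and y: "y \<in> S"
  shows "transition S Q t x y = (\<Sum>i<card S. exp (- lam i * t) * \<psi> i x * \<psi> i y * pmf \<pi> y)"
proof -
  have delta: "of_bool (z = y) = (\<Sum>i<card S. pmf \<pi> y * \<psi> i y * \<psi> i z)" if "z \<in> S" for z
  proof -
    have "coeff (\<lambda>z. of_bool (z = y)) i = pmf \<pi> y * \<psi> i y" for i
      unfolding coeff_def inner_pi_def using finite_S y
      by (simp add: of_bool_def if_distrib[of "\<lambda>u. u * _"] if_distrib[of "\<lambda>u. _ * u"] cong: if_cong)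
    then show ?thesis
      using expansion[OF that, of "\<lambda>z. of_bool (z = y)"] by simp
  qed
  have gp: "gen_power S Q j x y = (\<Sum>i<card S. pmf \<pi> y * \<psi> i y * \<psi> i x * (- lam i)^j)" for j
  proof -
    have "gen_power S Q j x y = (\<Sum>z\<in>S. gen_power S Q j x z * of_bool (z = y))"
      using finite_S y by (simp add: of_bool_def if_distrib[of "\<lambda>u. _ * u"] cong: if_cong)
    also have "\<dots> = (\<Sum>z\<in>S. gen_power S Q j x z * (\<Sum>i<card S. pmf \<pi> y * \<psi> i y * \<psi> i z))"
      by (intro sum.cong refl) (simp only: delta)
    also have "\<dots> = (\<Sum>i<card S. pmf \<pi> y * \<psi> i y * (\<Sum>z\<in>S. gen_power S Q j x z * \<psi> i z))"
      by (simp add: sum_distrib_left mult.left_commute) (subst sum.swap, rule refl)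
    also have "\<dots> = (\<Sum>i<card S. pmf \<pi> y * \<psi> i y * \<psi> i x * (- lam i)^j)"
      using x by (intro sum.cong refl) (simp add: gen_power_eigen)
    finally show ?thesis .
  qed
  have "(\<lambda>j. \<Sum>i<card S. pmf \<pi> y * \<psi> i y * \<psi> i x * ((- lam i * t)^j /\<^sub>R fact j))
      sums (\<Sum>i<card S. pmf \<pi> y * \<psi> i y * \<psi> i x * exp (- lam i * t))"
    by (intro sums_sum sums_mult exp_converges)
  moreover have "t^j / fact j * gen_power S Q j x y
      = (\<Sum>i<card S. pmf \<pi> y * \<psi> i y * \<psi> i x * ((- lam i * t)^j /\<^sub>R fact j))" for j
    unfolding gp sum_distrib_left power_mult_distrib
    by (intro sum.cong refl) (simp add: divide_inverse)
  ultimately show ?thesis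
    unfolding transition_def by (simp add: sums_iff mult_ac)
qed

lemma joint_nonneg: "0 \<le> joint t x y"
  by (simp add: joint_def)

lemma joint_spectral:
  assumes x: "x \<in> S" and y: "y \<in> S" and t: "0 < t"
  shows "joint t x y = pmf \<pi> x * pmf \<pi> y * (\<Sum>i<card S. exp (- lam i * t) * \<psi> i x * \<psi> i y)"
proof -
  interpret prob_space M
    by (rule prob_space_M)
  have init: "measure M {\<omega> \<in> space M. X 0 \<omega> = x} = pmf \<pi> x"
    using chain x by (simp add: markov_chain_def)
  have "joint t x y = pmf \<pi> x * transition S Q t x y"
  proof (cases "pmf \<pi> x = 0")
    case True
    have "joint t x y \<le> measure M {\<omega> \<in> space M. X 0 \<omega> = x}"
      unfolding joint_def by (intro finite_measure_mono) (auto intro!: measurable_sets_Collect)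
    then show ?thesis
      using True init joint_nonneg[of t x y] by simp
  next
    case False
    \<comment> \<open>The Markov property with the single past time \<open>0\<close>.\<close>
    define s where "s i = (if i = 0 then 0 else t)" for i :: nat
    define z where "z i = (if i = 0 then x else y)" for i :: nat
    have "0 < measure M {\<omega> \<in> space M. X 0 \<omega> = x}"
      unfolding init using False by (simp add: less_le)
    then have "cond_prob M (\<lambda>\<omega>. X (s (Suc 0)) \<omega> = z (Suc 0)) (\<lambda>\<omega>. \<forall>i\<le>0. X (s i) \<omega> = z i)
        = transition S Q (s (Suc 0) - s 0) (z 0) (z (Suc 0))"
      using chain x y t unfolding markov_chain_def
      by (elim conjE allE[of _ 0] allE[of _ s] allE[of _ z]) (simp add: s_def z_def)
    then have "joint t x y / pmf \<pi> x = transition S Q t x y"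
      by (simp add: s_def z_def cond_prob_def init joint_def conj_commute)
    then show ?thesis
      using False by (simp add: field_simps)
  qed
  then show ?thesis
    using x y by (simp add: transition_spectral sum_distrib_left sum_distrib_right mult_ac)
qed

lemma joint_sym: "x \<in> S \<Longrightarrow> y \<in> S \<Longrightarrow> 0 < t \<Longrightarrow> joint t x y = joint t y x"
  by (simp add: joint_spectral mult_ac)

lemma joint_bilinear:
  assumes "0 < t"
  shows "(\<Sum>x\<in>S. \<Sum>y\<in>S. joint t x y * (g x * h y))
    = (\<Sum>i<card S. exp (- lam i * t) * coeff g i * coeff h i)"
proof -
  have "(\<Sum>x\<in>S. \<Sum>y\<in>S. joint t x y * (g x * h y))
      = (\<Sum>x\<in>S. \<Sum>y\<in>S. \<Sum>i<card S.
          exp (- lam i * t) * ((pmf \<pi> x * g x * \<psi> i x) * (pmf \<pi> y * h y * \<psi> i y)))"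
    using assms
    by (intro sum.cong refl) (simp add: joint_spectral sum_distrib_left sum_distrib_right mult_ac)
  also have "\<dots> = (\<Sum>i<card S. \<Sum>x\<in>S. \<Sum>y\<in>S.
          exp (- lam i * t) * ((pmf \<pi> x * g x * \<psi> i x) * (pmf \<pi> y * h y * \<psi> i y)))"
    by (subst (2) sum.swap, subst sum.swap) (rule refl)
  also have "\<dots> = (\<Sum>i<card S. exp (- lam i * t) * (coeff g i * coeff h i))"
    unfolding coeff_def inner_pi_def sum_product by (simp only: sum_distrib_left)
  finally show ?thesis
    by (simp add: mult_ac)
qed

lemma coeff_one: "i < card S \<Longrightarrow> coeff (\<lambda>_. 1) i = of_bool (i = 0)"
  using mean_psi[of i] by (simp add: coeff_def inner_pi_def mean_def)

lemma joint_marginal: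
  assumes "0 < t"
  shows "(\<Sum>x\<in>S. \<Sum>y\<in>S. joint t x y * g x) = mean g"
proof -
  have "(\<Sum>x\<in>S. \<Sum>y\<in>S. joint t x y * g x)
      = (\<Sum>i<card S. exp (- lam i * t) * coeff g i * coeff (\<lambda>_. 1) i)"
    using joint_bilinear[OF assms, of g "\<lambda>_. 1"] by simp
  also have "\<dots> = (\<Sum>i<card S. if i = 0 then coeff g 0 else 0)"
    by (intro sum.cong refl) (simp add: coeff_one lam_0)
  finally show ?thesis
    using card_S by (simp add: coeff_0)
qed

lemma increment_energy:
  assumes "0 < t"
  shows "(\<Sum>x\<in>S. \<Sum>y\<in>S. joint t x y * (g x - g y)\<^sup>2)
    = 2 * (\<Sum>i<card S. (coeff g i)\<^sup>2 * (1 - exp (- lam i * t)))"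
proof -
  have "(\<Sum>x\<in>S. \<Sum>y\<in>S. joint t x y * (g x - g y)\<^sup>2)
      = (\<Sum>x\<in>S. \<Sum>y\<in>S. joint t x y * (g x)\<^sup>2) + (\<Sum>x\<in>S. \<Sum>y\<in>S. joint t x y * (g y)\<^sup>2)
        - 2 * (\<Sum>x\<in>S. \<Sum>y\<in>S. joint t x y * (g x * g y))"
    by (simp add: power2_diff algebra_simps sum.distrib sum_subtractf sum_distrib_left)
  also have "(\<Sum>x\<in>S. \<Sum>y\<in>S. joint t x y * (g y)\<^sup>2) = (\<Sum>y\<in>S. \<Sum>x\<in>S. joint t y x * (g y)\<^sup>2)"
    by (subst sum.swap) (intro sum.cong refl, simp add: joint_sym assms)
  also have "(\<Sum>x\<in>S. \<Sum>y\<in>S. joint t x y * (g x)\<^sup>2) + \<dots> = 2 * inner_pi S \<pi> g g"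
    unfolding joint_marginal[OF assms] mean_def inner_pi_def
    by (simp add: power2_eq_square mult_ac)
  finally show ?thesis
    unfolding joint_bilinear[OF assms] parseval
    by (simp add: power2_eq_square right_diff_distrib sum_subtractf mult_ac)
qed

lemma noise_eq_sum:
  assumes "0 \<le> t"
  shows "noise f t = (\<Sum>x\<in>S. \<Sum>y\<in>S. joint t x y * of_bool (f x \<noteq> f y))"
proof -
  interpret prob_space M
    by (rule prob_space_M)
  let ?A = "\<lambda>p. {\<omega> \<in> space M. X 0 \<omega> = fst p \<and> X t \<omega> = snd p}"
  let ?P = "{p \<in> S \<times> S. f (fst p) \<noteq> f (snd p)}"
  have meas: "?A p \<in> sets M" for p
    using assms by measurable
  have in_S: "X s \<omega> \<in> S" if "\<omega> \<in> space M" "0 \<le> s" for s \<omega>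
    using measurable_space[OF X_measurable[of s]] that by simp
  have "{\<omega> \<in> space M. f (X 0 \<omega>) \<noteq> f (X t \<omega>)} = (\<Union>p\<in>?P. ?A p)"
    using in_S assms by force
  then have "noise f t = (\<Sum>p\<in>?P. measure M (?A p))"
    unfolding noise_def using finite_S meas
    by (subst finite_measure_finite_Union[symmetric]) (auto simp: disjoint_family_on_def)
  also have "\<dots> = (\<Sum>p\<in>S \<times> S. joint t (fst p) (snd p) * of_bool (f (fst p) \<noteq> f (snd p)))"
    using finite_S by (intro sum.mono_neutral_cong_left) (auto simp: joint_def)
  finally show ?thesis
    by (simp add: sum.cartesian_product case_prod_beta)
qed

text \<open>
  For values in \<open>{0, 1}\<close> the squared difference is the indicator of a change.
\<close>

lemma noise_spectral:
  assumes "0 < t" and f: "f \<in> S \<rightarrow> {0, 1}"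
  shows "noise f t = 2 * (\<Sum>i<card S. (coeff f i)\<^sup>2 * (1 - exp (- lam i * t)))"
proof -
  have "of_bool (f x \<noteq> f y) = (f x - f y)\<^sup>2" if "x \<in> S" "y \<in> S" for x y
  proof -
    have "f x = 0 \<or> f x = 1" "f y = 0 \<or> f y = 1"
      using f that by auto
    then show ?thesis
      by auto
  qed
  then have "noise f t = (\<Sum>x\<in>S. \<Sum>y\<in>S. joint t x y * (f x - f y)\<^sup>2)"
    using assms(1) by (simp add: noise_eq_sum cong: sum.cong)
  then show ?thesis
    by (simp add: increment_energy assms(1))
qed

lemma noise_mono:
  assumes "0 < s" "s \<le> t" "f \<in> S \<rightarrow> {0, 1}"
  shows "noise f s \<le> noise f t"
  using assms lam_nonneg
  by (auto simp: noise_spectral intro!: sum_mono mult_left_mono)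

lemma noise_le_1: "noise f t \<le> 1"
  unfolding noise_def by (rule prob_space.prob_le_1[OF prob_space_M])

section \<open>Moments under the stationary distribution\<close>

lemma expectation_eq_mean: "measure_pmf.expectation \<pi> g = mean g"
  unfolding mean_def using set_pmf_subset
  by (subst integral_measure_pmf[OF finite_S]) auto

lemma prob_eq_mean: "measure_pmf.prob \<pi> {w \<in> S. P w} = mean (\<lambda>w. of_bool (P w))"
proof -
  have "measure_pmf.prob \<pi> {w \<in> S. P w} = (\<Sum>w\<in>{w \<in> S. P w}. pmf \<pi> w)"
    using finite_S by (simp add: measure_measure_pmf_finite)
  also have "\<dots> = mean (\<lambda>w. of_bool (P w))"
    unfolding mean_def using finite_S by (intro sum.mono_neutral_cong_left) auto
  finally show ?thesis .
qed

lemma inner_pi_eq_mean: "inner_pi S \<pi> g g = mean (\<lambda>w. (g w)\<^sup>2)"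
  by (simp add: mean_def inner_pi_def power2_eq_square mult_ac)

lemma mean_mono: "(\<And>w. w \<in> S \<Longrightarrow> g w \<le> h w) \<Longrightarrow> mean g \<le> mean h"
  unfolding mean_def by (intro sum_mono mult_left_mono) auto

lemma mean_cong: "(\<And>w. w \<in> S \<Longrightarrow> g w = h w) \<Longrightarrow> mean g = mean h"
  unfolding mean_def by (intro sum.cong) auto

lemma mean_add: "mean (\<lambda>w. g w + h w) = mean g + mean h"
  and mean_diff: "mean (\<lambda>w. g w - h w) = mean g - mean h"
  and mean_cmult: "mean (\<lambda>w. c * g w) = c * mean g"
  and mean_const: "mean (\<lambda>w. c) = c"
  using sum_pmf
  by (simp_all add: mean_def algebra_simps sum.distrib sum_subtractf sum_distrib_left
      flip: sum_distrib_left)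

lemma variance_Boolean:
  assumes "f \<in> S \<rightarrow> {0, 1}"
  shows "measure_pmf.variance \<pi> f = mean f * (1 - mean f)"
proof -
  have "measure_pmf.variance \<pi> f = mean (\<lambda>w. (f w - mean f)\<^sup>2)"
    by (simp add: expectation_eq_mean)
  also have "\<dots> = mean (\<lambda>w. (1 - 2 * mean f) * f w + (mean f)\<^sup>2)"
  proof (intro mean_cong)
    fix w assume "w \<in> S"
    then have "f w = 0 \<or> f w = 1"
      using assms by auto
    then show "(f w - mean f)\<^sup>2 = (1 - 2 * mean f) * f w + (mean f)\<^sup>2"
      by (auto simp: power2_eq_square algebra_simps)
  qed
  also have "\<dots> = mean f * (1 - mean f)"
    by (simp only: mean_add mean_cmult mean_const) (simp add: power2_eq_square algebra_simps)
  finally show ?thesis .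
qed

text \<open>
  Cauchy-Schwarz, used as a lower bound on probability: a function with second moment at most
  \<open>1\<close> can collect mean only on an event that is not too small.
\<close>

lemma mean_abs_on_event_le:
  assumes "mean (\<lambda>w. (g w)\<^sup>2) \<le> 1"
  shows "(mean (\<lambda>w. \<bar>g w\<bar> * of_bool (P w)))\<^sup>2 \<le> mean (\<lambda>w. of_bool (P w))"
proof -
  have of_bool_sq: "(of_bool b)\<^sup>2 = (of_bool b :: real)" for b
    by (cases b) auto
  have "mean (\<lambda>w. \<bar>g w\<bar> * of_bool (P w))
      = (\<Sum>w\<in>S. (sqrt (pmf \<pi> w) * \<bar>g w\<bar>) * (sqrt (pmf \<pi> w) * of_bool (P w)))"
    unfolding mean_def by (intro sum.cong refl) (simp add: mult_ac flip: real_sqrt_mult)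
  also have "(\<dots>)\<^sup>2 \<le> (\<Sum>w\<in>S. (sqrt (pmf \<pi> w) * \<bar>g w\<bar>)\<^sup>2) * (\<Sum>w\<in>S. (sqrt (pmf \<pi> w) * of_bool (P w))\<^sup>2)"
    by (rule Cauchy_Schwarz_ineq_sum)
  also have "\<dots> = mean (\<lambda>w. (g w)\<^sup>2) * mean (\<lambda>w. of_bool (P w))"
    unfolding mean_def by (simp add: power_mult_distrib of_bool_sq)
  also have "\<dots> \<le> 1 * mean (\<lambda>w. of_bool (P w))"
    by (intro mult_right_mono assms) (auto simp: mean_def intro!: sum_nonneg)
  finally show ?thesis
    by simp
qed

section \<open>From a noise stable function to a low frequency function\<close>

lemma psi_1_in_low_span:
  assumes "1 \<le> k"
  shows "\<psi> 1 \<in> low_span S lam \<psi> k"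
proof -
  have "1 \<in> {i. i < card S \<and> lam 1 \<le> lam i \<and> lam i \<le> k * lam 1}"
    using assms card_S lam_1 by simp
  then have "\<psi> 1 w = (\<Sum>i | i < card S \<and> lam 1 \<le> lam i \<and> lam i \<le> k * lam 1. of_bool (i = 1) * \<psi> i w)"
    for w
    by (simp add: of_bool_def if_distrib[of "\<lambda>u. u * _"] cong: if_cong)
  then show ?thesis
    unfolding low_span_def mem_Collect_eq by (intro exI[of _ "\<lambda>i. of_bool (i = 1)"] ballI)
qed

lemma mean_square_expansion:
  assumes g: "\<And>w. w \<in> S \<Longrightarrow> g w = (\<Sum>i\<in>I. c i * \<psi> i w)" and I: "I \<subseteq> {..<card S}"
  shows "mean (\<lambda>w. (g w)\<^sup>2) = (\<Sum>i\<in>I. (c i)\<^sup>2)"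
proof -
  have "mean (\<lambda>w. (g w)\<^sup>2) = (\<Sum>i<card S. (coeff g i)\<^sup>2)"
    using parseval inner_pi_eq_mean by metis
  also have "\<dots> = (\<Sum>i\<in>I. (c i)\<^sup>2)"
    using I by (intro sum.mono_neutral_cong_right) (auto simp: coeff_expansion[OF g I])
  finally show ?thesis .
qed

text \<open>
  A frequency above \<open>lam 1 / \<alpha>\<close> has decayed at least by the factor \<open>exp (- 1) \<le> 1 / 2\<close> after \<open>\<alpha>\<close>
  relaxation times, so it contributes at least its whole energy to the noise.
\<close>

lemma high_frequency_energy_le_noise:
  assumes f: "f \<in> S \<rightarrow> {0, 1}" and \<alpha>: "0 < \<alpha>"
  shows "(\<Sum>i | i < card S \<and> lam 1 < \<alpha> * lam i. (coeff f i)\<^sup>2) \<le> noise f (\<alpha> * relaxation_time lam)"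
proof -
  let ?t = "\<alpha> * relaxation_time lam"
  have t: "0 < ?t"
    using \<alpha> lam_1 by (simp add: relaxation_time_def)
  have "2 * (1 / 2) \<le> 2 * (1 - exp (- lam i * ?t))" if "lam 1 < \<alpha> * lam i" for i
  proof -
    have "1 \<le> lam i * ?t"
      using that lam_1 by (simp add: relaxation_time_def field_simps)
    then have "exp (- lam i * ?t) \<le> exp (- 1)"
      by simp
    also have "\<dots> \<le> 1 / (2 :: real)"
      using exp_ge_add_one_self[of 1] by (simp add: exp_minus field_simps)
    finally show ?thesis
      by simp
  qed
  then have "(\<Sum>i | i < card S \<and> lam 1 < \<alpha> * lam i. (coeff f i)\<^sup>2 * 1)
      \<le> (\<Sum>i | i < card S \<and> lam 1 < \<alpha> * lam i. (coeff f i)\<^sup>2 * (2 * (1 - exp (- lam i * ?t))))"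
    by (intro sum_mono mult_left_mono) auto
  also have "\<dots> \<le> (\<Sum>i<card S. (coeff f i)\<^sup>2 * (2 * (1 - exp (- lam i * ?t))))"
    using lam_nonneg t by (intro sum_mono2) (auto intro!: mult_nonneg_nonneg)
  finally show ?thesis
    unfolding noise_spectral[OF t f] sum_distrib_left by (simp only: mult.left_commute mult_1_right)
qed

text \<open>
  Write \<open>f = p + g + h\<close> with \<open>p\<close> the mean, \<open>g\<close> the frequencies up to \<open>lam 1 / \<alpha>\<close> and \<open>h\<close> the rest. A variance
  of at least \<open>v\<close> forces \<open>\<bar>f - p\<bar> \<ge> v\<close> everywhere, so \<open>\<bar>g\<bar>\<close> falls below \<open>v / 2\<close> only where
  \<open>\<bar>h\<bar> \<ge> v / 2\<close>. The bound \<open>v\<^sup>2 / 8\<close> on the energy of \<open>h\<close> makes that event have probability at most \<open>1 / 2\<close>.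
  Dividing \<open>g\<close> by its norm, which is at most \<open>1\<close>, only increases it.
\<close>

lemma low_frequency_part_of_stable_function:
  assumes f: "f \<in> S \<rightarrow> {0, 1}" and v: "0 < v" "v \<le> measure_pmf.variance \<pi> f"
    and \<alpha>: "0 < \<alpha>" and stable: "noise f (\<alpha> * relaxation_time lam) \<le> v\<^sup>2 / 8"
  shows "\<exists>\<phi> \<in> low_span S lam \<psi> (1 / \<alpha>). inner_pi S \<pi> \<phi> \<phi> = 1 \<and>
    measure_pmf.prob \<pi> {w \<in> S. (\<phi> w)\<^sup>2 < v\<^sup>2 / 4} \<le> 1 / 2"
proof -
  define L where "L = {i. i < card S \<and> lam 1 \<le> lam i \<and> lam i \<le> 1 / \<alpha> * lam 1}"
  define H where "H = {i. i < card S \<and> i \<noteq> 0 \<and> 1 / \<alpha> * lam 1 < lam i}"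
  define p where "p = mean f"
  define g where "g w = (\<Sum>i\<in>L. coeff f i * \<psi> i w)" for w
  define h where "h w = (\<Sum>i\<in>H. coeff f i * \<psi> i w)" for w
  define q where "q = mean (\<lambda>w. (g w)\<^sup>2)"
  have split: "{..<card S} = insert 0 (L \<union> H)" "0 \<notin> L \<union> H" "L \<inter> H = {}" "finite L" "finite H"
    using card_S by (auto simp: L_def H_def lam_1_le_iff simp del: One_nat_def)
  have LH: "L \<subseteq> {..<card S}" "H \<subseteq> {..<card S}"
    using split(1) by auto
  have f_eq: "f w = p + g w + h w" if "w \<in> S" for w
    unfolding expansion[OF that, of f] split(1) g_def h_def p_def using split that
    by (simp add: sum.union_disjoint coeff_0 psi_0)
  have var: "p * (1 - p) = q + mean (\<lambda>w. (h w)\<^sup>2)"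
  proof -
    have "(f w)\<^sup>2 = f w" if "w \<in> S" for w
    proof -
      have "f w = 0 \<or> f w = 1"
        using f that by auto
      then show ?thesis
        by auto
    qed
    then have "p = mean (\<lambda>w. (f w)\<^sup>2)"
      unfolding p_def by (intro mean_cong) simp
    also have "\<dots> = (\<Sum>i<card S. (coeff f i)\<^sup>2)"
      by (intro mean_square_expansion expansion) auto
    also have "\<dots> = p\<^sup>2 + (\<Sum>i\<in>L. (coeff f i)\<^sup>2) + (\<Sum>i\<in>H. (coeff f i)\<^sup>2)"
      unfolding split(1) using split(2-) by (simp add: sum.union_disjoint coeff_0 p_def)
    finally show ?thesis
      unfolding q_def using mean_square_expansion[OF g_def LH(1)] mean_square_expansion[OF h_def LH(2)]
      by (simp add: power2_eq_square algebra_simps)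
  qed
  have p01: "0 \<le> p" "p \<le> 1"
  proof -
    have "0 \<le> f w \<and> f w \<le> 1" if "w \<in> S" for w
    proof -
      have "f w = 0 \<or> f w = 1"
        using f that by auto
      then show ?thesis
        by auto
    qed
    then show "0 \<le> p" "p \<le> 1"
      unfolding p_def using mean_mono[of "\<lambda>_. 0" f] mean_mono[of f "\<lambda>_. 1"] by (auto simp: mean_const)
  qed
  have vp: "v \<le> p * (1 - p)"
    using v(2) variance_Boolean[OF f] by (simp add: p_def)
  have p_ge: "v \<le> p" "v \<le> 1 - p"
    using vp p01 mult_left_le[of "1 - p" p] mult_left_le_one_le[of "1 - p" p] by linarith+
  have "p * (1 - p) \<le> 1 / 4"
    using zero_le_power2[of "p - 1/2"] by (simp add: power2_eq_square algebra_simps)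
  have H_small: "mean (\<lambda>w. (h w)\<^sup>2) \<le> v\<^sup>2 / 8"
  proof -
    have "i \<noteq> 0" if "lam 1 < \<alpha> * lam i" for i
      using that lam_0 lam_1 by (cases "i = 0") auto
    then have "H = {i. i < card S \<and> lam 1 < \<alpha> * lam i}"
      using \<alpha> by (auto simp: H_def field_simps)
    then show ?thesis
      using high_frequency_energy_le_noise[OF f \<alpha>] stable mean_square_expansion[OF h_def LH(2)]
      by simp
  qed
  have h_nonneg: "0 \<le> mean (\<lambda>w. (h w)\<^sup>2)"
    using mean_mono[of "\<lambda>_. 0" "\<lambda>w. (h w)\<^sup>2"] by (simp add: mean_const)
  have "v\<^sup>2 \<le> v"
    using v(1) p_ge p01 by (simp add: power2_eq_square)
  then have q: "0 < q" "q \<le> 1"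
    using var vp H_small h_nonneg v(1) \<open>p * (1 - p) \<le> 1 / 4\<close> by linarith+
  define \<phi> where "\<phi> w = g w / sqrt q" for w
  have \<phi>_sq: "(\<phi> w)\<^sup>2 = 1 / q * (g w)\<^sup>2" for w
    using q by (simp add: \<phi>_def power_divide)
  have "\<phi> w = (\<Sum>i\<in>L. coeff f i / sqrt q * \<psi> i w)" for w
    by (simp add: \<phi>_def g_def sum_divide_distrib)
  then have "\<phi> \<in> low_span S lam \<psi> (1 / \<alpha>)"
    unfolding low_span_def L_def mem_Collect_eq by (intro exI[of _ "\<lambda>i. coeff f i / sqrt q"] ballI)
  moreover have "inner_pi S \<pi> \<phi> \<phi> = 1"
    unfolding inner_pi_eq_mean \<phi>_sq mean_cmult using q by (simp add: q_def)
  moreover have "measure_pmf.prob \<pi> {w \<in> S. (\<phi> w)\<^sup>2 < v\<^sup>2 / 4} \<le> 1 / 2"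
  proof -
    have "of_bool ((\<phi> w)\<^sup>2 < v\<^sup>2 / 4) \<le> 4 / v\<^sup>2 * (h w)\<^sup>2" if w: "w \<in> S" for w
    proof (cases "(\<phi> w)\<^sup>2 < v\<^sup>2 / 4")
      case True
      have "(g w)\<^sup>2 = q * (\<phi> w)\<^sup>2"
        using q by (simp add: \<phi>_sq)
      also have "\<dots> \<le> (\<phi> w)\<^sup>2"
        using q by (intro mult_left_le_one_le) auto
      finally have "(g w)\<^sup>2 < (v / 2)\<^sup>2"
        using True by (simp add: power_divide)
      then have "\<bar>g w\<bar> < v / 2"
        using v(1) power2_less_imp_less[of "\<bar>g w\<bar>" "v / 2"] by simp
      moreover have "f w = 0 \<or> f w = 1"
        using f w by auto
      ultimately have "v / 2 \<le> \<bar>h w\<bar>"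
        using f_eq[OF w] p_ge p01 by linarith
      then have "(v / 2)\<^sup>2 \<le> (h w)\<^sup>2"
        using v(1) by (metis abs_le_square_iff abs_of_pos half_gt_zero)
      then show ?thesis
        using True v(1) by (simp add: power_divide field_simps)
    qed simp
    then have "measure_pmf.prob \<pi> {w \<in> S. (\<phi> w)\<^sup>2 < v\<^sup>2 / 4} \<le> mean (\<lambda>w. 4 / v\<^sup>2 * (h w)\<^sup>2)"
      unfolding prob_eq_mean by (rule mean_mono)
    also have "\<dots> \<le> 4 / v\<^sup>2 * (v\<^sup>2 / 8)"
      unfolding mean_cmult by (intro mult_left_mono H_small) simp
    finally show ?thesis
      using v(1) by simp
  qed
  ultimately show ?thesis
    by blast
qed

section \<open>From a low frequency function to a noise stable level set\<close>

text \<open>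
  The coarea formula for the joint law: the levels that separate \<open>g x\<close> from \<open>g y\<close> form an interval of
  length \<open>\<bar>g x - g y\<bar>\<close>.
\<close>

lemma level_noise_integral:
  assumes "0 \<le> t"
  shows "(\<lambda>a. noise (\<lambda>w. of_bool (a < g w)) t) \<in> borel_measurable borel"
    and "(\<integral>\<^sup>+a. ennreal (noise (\<lambda>w. of_bool (a < g w)) t) \<partial>lborel)
      = ennreal (\<Sum>x\<in>S. \<Sum>y\<in>S. joint t x y * \<bar>g x - g y\<bar>)"
proof -
  have eq: "noise (\<lambda>w. of_bool (a < g w)) t
      = (\<Sum>x\<in>S. \<Sum>y\<in>S. joint t x y * of_bool ((a < g x) \<noteq> (a < g y)))" for a
    using assms by (simp add: noise_eq_sum of_bool_eq_iff)
  have [measurable]: "(\<lambda>a::real. of_bool ((a < b) \<noteq> (a < c)) :: real) \<in> borel_measurable borel" for b c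
    by (simp add: of_bool_def)
  show "(\<lambda>a. noise (\<lambda>w. of_bool (a < g w)) t) \<in> borel_measurable borel"
    unfolding eq by measurable
  have "(\<integral>\<^sup>+a. ennreal (noise (\<lambda>w. of_bool (a < g w)) t) \<partial>lborel)
      = (\<integral>\<^sup>+a. (\<Sum>x\<in>S. \<Sum>y\<in>S. ennreal (joint t x y) * ennreal (of_bool ((a < g x) \<noteq> (a < g y)))) \<partial>lborel)"
    unfolding eq by (simp add: sum_ennreal sum_nonneg joint_nonneg ennreal_mult'' flip: sum_ennreal ennreal_mult'')
  also have "\<dots> = (\<Sum>x\<in>S. \<Sum>y\<in>S. ennreal (joint t x y) *
      (\<integral>\<^sup>+a. ennreal (of_bool ((a < g x) \<noteq> (a < g y))) \<partial>lborel))"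
    by (simp add: nn_integral_sum nn_integral_cmult)
  also have "\<dots> = ennreal (\<Sum>x\<in>S. \<Sum>y\<in>S. joint t x y * \<bar>g x - g y\<bar>)"
    by (simp add: nn_integral_separating_level sum_nonneg joint_nonneg ennreal_mult del: not_iff
        flip: sum_ennreal)
  finally show "(\<integral>\<^sup>+a. ennreal (noise (\<lambda>w. of_bool (a < g w)) t) \<partial>lborel)
      = ennreal (\<Sum>x\<in>S. \<Sum>y\<in>S. joint t x y * \<bar>g x - g y\<bar>)" .
qed

text \<open>
  All frequencies of \<open>\<phi>\<close> are at most \<open>k * lam 1\<close>, and \<open>1 - exp (- u) \<le> u\<close>; this bounds the mean squared
  increment, and Jensen's inequality passes to the absolute one.
\<close>

lemma low_span_increment:
  assumes \<phi>: "\<phi> \<in> low_span S lam \<psi> k" and norm: "inner_pi S \<pi> \<phi> \<phi> = 1"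
    and "0 < \<alpha>" "0 < k"
  shows "(\<Sum>x\<in>S. \<Sum>y\<in>S. joint (\<alpha> * relaxation_time lam) x y * \<bar>\<phi> x - \<phi> y\<bar>) \<le> sqrt (2 * k * \<alpha>)"
proof -
  let ?t = "\<alpha> * relaxation_time lam"
  let ?L = "{i. i < card S \<and> lam 1 \<le> lam i \<and> lam i \<le> k * lam 1}"
  obtain c where c: "\<And>w. w \<in> S \<Longrightarrow> \<phi> w = (\<Sum>i\<in>?L. c i * \<psi> i w)"
    using \<phi> unfolding low_span_def by blast
  have coeff: "coeff \<phi> i = (if i \<in> ?L then c i else 0)" if "i < card S" for i
    using that by (intro coeff_expansion[OF c]) auto
  have t: "0 < ?t"
    using lam_1 assms(3) by (simp add: relaxation_time_def)
  have "(coeff \<phi> i)\<^sup>2 * (1 - exp (- lam i * ?t)) \<le> (coeff \<phi> i)\<^sup>2 * (k * \<alpha>)" if "i < card S" for i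
  proof (cases "i \<in> ?L")
    case True
    have "1 - exp (- lam i * ?t) \<le> lam i * ?t"
      using exp_ge_add_one_self[of "- lam i * ?t"] by simp
    also have "\<dots> \<le> k * lam 1 * ?t"
      using True t by (intro mult_right_mono) auto
    also have "\<dots> = k * \<alpha>"
      using lam_1 by (simp add: relaxation_time_def)
    finally show ?thesis
      by (intro mult_left_mono) auto
  next
    case False
    then show ?thesis
      using coeff[OF that] by auto
  qed
  then have "(\<Sum>i<card S. (coeff \<phi> i)\<^sup>2 * (1 - exp (- lam i * ?t))) \<le> (\<Sum>i<card S. (coeff \<phi> i)\<^sup>2 * (k * \<alpha>))"
    by (intro sum_mono) auto
  also have "\<dots> = k * \<alpha>"
    using norm by (simp add: parseval flip: sum_distrib_right)
  finally have energy: "(\<Sum>x\<in>S. \<Sum>y\<in>S. joint ?t x y * (\<phi> x - \<phi> y)\<^sup>2) \<le> 2 * k * \<alpha>"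
    by (simp add: increment_energy t)
  have mass: "(\<Sum>x\<in>S. \<Sum>y\<in>S. joint ?t x y) = 1"
    using joint_marginal[OF t, of "\<lambda>_. 1"] by (simp add: mean_const)
  have "(\<Sum>p\<in>S \<times> S. joint ?t (fst p) (snd p) * \<bar>\<phi> (fst p) - \<phi> (snd p)\<bar>)
      \<le> sqrt (\<Sum>p\<in>S \<times> S. joint ?t (fst p) (snd p) * (\<phi> (fst p) - \<phi> (snd p))\<^sup>2)"
    using mass by (intro weighted_abs_sum_le_sqrt joint_nonneg) (simp add: sum.cartesian_product case_prod_beta)
  also have "\<dots> \<le> sqrt (2 * k * \<alpha>)"
    using energy by (simp add: sum.cartesian_product case_prod_beta)
  finally show ?thesis
    by (simp add: sum.cartesian_product case_prod_beta)
qed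

lemma mean_low_span:
  assumes "\<phi> \<in> low_span S lam \<psi> k"
  shows "mean \<phi> = 0"
proof -
  obtain c where "\<And>w. w \<in> S \<Longrightarrow>
      \<phi> w = (\<Sum>i | i < card S \<and> lam 1 \<le> lam i \<and> lam i \<le> k * lam 1. c i * \<psi> i w)"
    using assms unfolding low_span_def by blast
  then have "coeff \<phi> 0 = 0"
    using card_S lam_0 lam_1 by (subst coeff_expansion) auto
  then show ?thesis
    by (simp add: coeff_0)
qed

text \<open>
  Since \<open>\<phi>\<close> is centred, its positive and negative parts each have mean at least \<open>m / 2\<close>. Cutting the
  positive part at a level \<open>a \<le> m / 4\<close> loses at most \<open>a\<close>, so both the level set and its complement carry
  a share of at least \<open>m / 4\<close> of the mean of \<open>\<bar>\<phi>\<bar>\<close>, and hence probability at least \<open>(m / 4)\<^sup>2\<close>.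
\<close>

lemma variance_level_set_ge:
  assumes centred: "mean \<phi> = 0" and norm: "mean (\<lambda>w. (\<phi> w)\<^sup>2) \<le> 1"
    and m: "0 < m" "m \<le> mean (\<lambda>w. \<bar>\<phi> w\<bar>)" and a: "0 \<le> a" "a \<le> m / 4"
  shows "m\<^sup>2 / 32 \<le> measure_pmf.variance \<pi> (\<lambda>w. of_bool (a < \<phi> w))"
proof -
  define pos neg where "pos = mean (\<lambda>w. \<bar>\<phi> w\<bar> * of_bool (0 < \<phi> w))"
    and "neg = mean (\<lambda>w. \<bar>\<phi> w\<bar> * of_bool (\<phi> w < 0))"
  define p where "p = mean (\<lambda>w. of_bool (a < \<phi> w))"
  have "pos + neg = mean (\<lambda>w. \<bar>\<phi> w\<bar>)" "pos - neg = mean \<phi>"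
    unfolding pos_def neg_def mean_add[symmetric] mean_diff[symmetric] by (intro mean_cong; auto)+
  then have half: "m / 2 \<le> pos" "m / 2 \<le> neg"
    using m centred by auto
  have "pos \<le> mean (\<lambda>w. \<bar>\<phi> w\<bar> * of_bool (a < \<phi> w) + a)"
    unfolding pos_def using a by (intro mean_mono) auto
  then have "m / 4 \<le> mean (\<lambda>w. \<bar>\<phi> w\<bar> * of_bool (a < \<phi> w))"
    using half a by (simp add: mean_add mean_const)
  then have "(m / 4)\<^sup>2 \<le> (mean (\<lambda>w. \<bar>\<phi> w\<bar> * of_bool (a < \<phi> w)))\<^sup>2"
    using m by (intro power_mono) auto
  also have "\<dots> \<le> p"
    unfolding p_def by (rule mean_abs_on_event_le[OF norm])
  finally have p1: "m\<^sup>2 / 16 \<le> p"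
    by (simp add: power_divide)
  have "m\<^sup>2 / 16 \<le> (m / 2)\<^sup>2"
    by (simp add: power_divide)
  also have "\<dots> \<le> neg\<^sup>2"
    using m half by (intro power_mono) auto
  also have "\<dots> \<le> mean (\<lambda>w. of_bool (\<phi> w < 0))"
    unfolding neg_def by (rule mean_abs_on_event_le[OF norm])
  also have "\<dots> \<le> mean (\<lambda>w. 1 - of_bool (a < \<phi> w))"
    using a by (intro mean_mono) auto
  finally have p2: "m\<^sup>2 / 16 \<le> 1 - p"
    by (simp add: mean_diff mean_const p_def)
  have "m\<^sup>2 / 32 \<le> p * (1 - p)"
  proof (cases "p \<le> 1 / 2")
    case True
    then have "m\<^sup>2 / 16 * (1 / 2) \<le> p * (1 - p)"
      using p1 p2 by (intro mult_mono) (auto intro: order_trans[OF _ p1])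
    then show ?thesis by simp
  next
    case False
    then have "1 / 2 * (m\<^sup>2 / 16) \<le> p * (1 - p)"
      using p1 p2 by (intro mult_mono) auto
    then show ?thesis by simp
  qed
  also have "p * (1 - p) = measure_pmf.variance \<pi> (\<lambda>w. of_bool (a < \<phi> w))"
    by (subst variance_Boolean) (auto simp: p_def)
  finally show ?thesis .
qed

text \<open>
  The constant \<open>m\<close> is the lower bound for the mean of \<open>\<bar>\<phi>\<bar>\<close> that comes from
  \<open>\<bar>\<phi>\<bar> \<ge> sqrt \<epsilon>\<close> on an event of probability more than \<open>\<epsilon>\<close>. The ratio \<open>1/16\<close> of consecutive times is chosen
  so that the increments \<open>sqrt (2 * k * (1/16) ^ j)\<close> decay like \<open>(1/4) ^ j\<close>.
\<close>

lemma stable_level_set: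
  assumes \<phi>: "\<phi> \<in> low_span S lam \<psi> k" and norm: "inner_pi S \<pi> \<phi> \<phi> = 1"
    and "0 < \<epsilon>" "0 < k" and spread: "measure_pmf.prob \<pi> {w \<in> S. (\<phi> w)\<^sup>2 < \<epsilon>} < 1 - \<epsilon>"
  defines "m \<equiv> \<epsilon> * sqrt \<epsilon>"
  shows "\<exists>f \<in> S \<rightarrow> {0, 1}. m\<^sup>2 / 32 \<le> measure_pmf.variance \<pi> f \<and>
    (\<forall>j. noise f ((1/16)^j * relaxation_time lam) \<le> 16 * sqrt (2 * k) / m * (1/2)^j)"
proof -
  have m: "0 < m"
    using assms(3) by (simp add: m_def)
  let ?p = "\<lambda>j a. noise (\<lambda>w. of_bool (a < \<phi> w)) ((1/16)^j * relaxation_time lam)"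
  have t: "0 \<le> (1/16)^j * relaxation_time lam" for j
    using lam_1 by (simp add: relaxation_time_def)
  have "(\<integral>\<^sup>+a. ennreal (?p j a) \<partial>lborel) \<le> ennreal (sqrt (2 * k) * (1/4)^j)" for j
  proof -
    have "sqrt (2 * k * (1/16)^j) = sqrt (2 * k) * sqrt ((1/16)^j)"
      by (rule real_sqrt_mult)
    also have "sqrt ((1/16)^j) = (1/4)^j"
      by (simp add: real_sqrt_power real_sqrt_divide)
    finally show ?thesis
      unfolding level_noise_integral(2)[OF t]
      using low_span_increment[OF \<phi> norm _ assms(4), of "(1/16)^j"] by (intro ennreal_leI) simp
  qed
  then obtain a where a: "a \<in> {0..m / 4}" and noise: "\<And>j. ?p j a \<le> 4 * sqrt (2 * k) / (m / 4) * (1/2)^j"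
    using exists_point_good_at_all_scales[of ?p "sqrt (2 * k)" "m / 4", OF level_noise_integral(1)[OF t]]
      m assms(4) by auto
  have "1 - measure_pmf.prob \<pi> {w \<in> S. (\<phi> w)\<^sup>2 < \<epsilon>} = mean (\<lambda>w. 1 - of_bool ((\<phi> w)\<^sup>2 < \<epsilon>))"
    by (simp add: prob_eq_mean mean_diff mean_const)
  then have "m \<le> mean (\<lambda>w. 1 - of_bool ((\<phi> w)\<^sup>2 < \<epsilon>)) * sqrt \<epsilon>"
    unfolding m_def using spread assms(3) by (intro mult_right_mono) auto
  also have "\<dots> = mean (\<lambda>w. sqrt \<epsilon> * (1 - of_bool ((\<phi> w)\<^sup>2 < \<epsilon>)))"
    by (simp add: mean_cmult)
  also have "\<dots> \<le> mean (\<lambda>w. \<bar>\<phi> w\<bar>)"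
  proof (intro mean_mono)
    fix w
    show "sqrt \<epsilon> * (1 - of_bool ((\<phi> w)\<^sup>2 < \<epsilon>)) \<le> \<bar>\<phi> w\<bar>"
      using real_sqrt_le_mono[of \<epsilon> "(\<phi> w)\<^sup>2"] by (cases "(\<phi> w)\<^sup>2 < \<epsilon>") auto
  qed
  finally have "m\<^sup>2 / 32 \<le> measure_pmf.variance \<pi> (\<lambda>w. of_bool (a < \<phi> w))"
    using mean_low_span[OF \<phi>] norm m a
    by (intro variance_level_set_ge) (auto simp: inner_pi_eq_mean)
  then show ?thesis
    using noise by (intro bexI[of _ "\<lambda>w. of_bool (a < \<phi> w)"]) auto
qed

end

section \<open>The equivalence\<close>

theorem proposition3p1:
  fixes S :: "nat \<Rightarrow> 'a set"
    and Q :: "nat \<Rightarrow> 'a \<Rightarrow> 'a \<Rightarrow> real"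
    and \<pi> :: "nat \<Rightarrow> 'a pmf"
    and M :: "nat \<Rightarrow> 'w measure"
    and X :: "nat \<Rightarrow> real \<Rightarrow> 'w \<Rightarrow> 'a"
    and lam :: "nat \<Rightarrow> nat \<Rightarrow> real"
    and \<psi> :: "nat \<Rightarrow> nat \<Rightarrow> 'a \<Rightarrow> real"
  assumes "\<And>n. n \<ge> 1 \<Longrightarrow> finite (S n)"
    and "\<And>n. n \<ge> 1 \<Longrightarrow> card (S n) \<ge> 2"
    and "\<And>n. n \<ge> 1 \<Longrightarrow> stationary_distribution (S n) (Q n) (\<pi> n)"
    and "\<And>n. n \<ge> 1 \<Longrightarrow> markov_chain (M n) (S n) (Q n) (\<pi> n) (X n)"
    and "\<And>n. n \<ge> 1 \<Longrightarrow> reversible (S n) (Q n) (\<pi> n)"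
    and "\<And>n. n \<ge> 1 \<Longrightarrow> irreducible_generator (S n) (Q n)"
    and "\<And>n. n \<ge> 1 \<Longrightarrow> spectral_basis (S n) (Q n) (\<pi> n) (lam n) (\<psi> n)"
  shows
    "(\<exists>f :: nat \<Rightarrow> 'a \<Rightarrow> real.
        boolean_functions S f \<and> nondegenerate \<pi> f \<and>
        noise_stable M X (\<lambda>n. relaxation_time (lam n)) f)
     \<longleftrightarrow>
     (\<exists>\<epsilon>>0. \<exists>k>0. \<exists>\<phi> :: nat \<Rightarrow> 'a \<Rightarrow> real.
        (\<forall>n\<ge>1. \<phi> n \<in> low_span (S n) (lam n) (\<psi> n) k \<and>
                inner_pi (S n) (\<pi> n) (\<phi> n) (\<phi> n) = 1) \<and>
        (\<forall>\<^sub>F n in sequentially.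
           measure_pmf.prob (\<pi> n) {w \<in> S n. (\<phi> n w)\<^sup>2 < \<epsilon>} < 1 - \<epsilon>))"
    (is "?A \<longleftrightarrow> ?B")
proof
  have sc: "spectral_chain (M n) (S n) (Q n) (\<pi> n) (X n) (lam n) (\<psi> n)" if "n \<ge> 1" for n
    using assms(1-4,7)[OF that] by (simp add: spectral_chain_def)
  let ?noise = "\<lambda>n f t. measure (M n) {\<omega> \<in> space (M n). f (X n 0 \<omega>) \<noteq> f (X n t \<omega>)}"
  let ?rel = "\<lambda>n. relaxation_time (lam n)"
  have noise: "spectral_chain.noise (M n) (X n) f t = ?noise n f t" if "n \<ge> 1" for n f t
    by (rule spectral_chain.noise_def[OF sc[OF that]])
  have noise_le_1: "?noise n f t \<le> 1" if "n \<ge> 1" for n t and f :: "'a \<Rightarrow> real"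
    using spectral_chain.noise_le_1[OF sc[OF that]] noise[OF that] by metis
  have noise_le_SUP: "?noise n (f n) (\<alpha> * ?rel n) \<le> (SUP n\<in>{1..}. ?noise n (f n) (\<alpha> * ?rel n))"
    if "n \<ge> 1" for n \<alpha> and f :: "nat \<Rightarrow> 'a \<Rightarrow> real"
    using that by (intro cSUP_upper bdd_aboveI2[where M=1] noise_le_1) auto

  show ?B if ?A
  proof -
    obtain f where f: "boolean_functions S f" "nondegenerate \<pi> f" "noise_stable M X ?rel f"
      using \<open>?A\<close> by blast
    obtain v where v: "0 < v" "\<forall>\<^sub>F n in sequentially. v \<le> measure_pmf.variance (\<pi> n) (f n)"
    proof -
      obtain v where "0 < ereal v" "ereal v < liminf (\<lambda>n. ereal (measure_pmf.variance (\<pi> n) (f n)))"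
        using f(2) ereal_dense2 unfolding nondegenerate_def by blast
      then have "0 < v" "\<forall>\<^sub>F n in sequentially. v < measure_pmf.variance (\<pi> n) (f n)"
        by (auto dest!: less_LiminfD)
      then show thesis
        by (intro that) (auto elim: eventually_mono intro: less_imp_le)
    qed
    obtain \<alpha> where \<alpha>: "0 < \<alpha>" "\<alpha> \<le> 1" and stable: "\<And>n. n \<ge> 1 \<Longrightarrow> ?noise n (f n) (\<alpha> * ?rel n) \<le> v\<^sup>2 / 8"
    proof -
      let ?s = "\<lambda>\<alpha>. SUP n\<in>{1..}. ?noise n (f n) (\<alpha> * ?rel n)"
      have "\<forall>\<^sub>F \<alpha> in at_right 0. dist (?s \<alpha>) 0 < v\<^sup>2 / 8"
        using f(3) v(1) unfolding noise_stable_def by (intro tendstoD) auto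
      then obtain b where b: "0 < b" "\<And>\<alpha>. 0 < \<alpha> \<Longrightarrow> \<alpha> < b \<Longrightarrow> dist (?s \<alpha>) 0 < v\<^sup>2 / 8"
        unfolding eventually_at_right_field by auto
      define \<alpha> where "\<alpha> = min 1 (b / 2)"
      have \<alpha>: "0 < \<alpha>" "\<alpha> \<le> 1" "\<alpha> < b"
        using b(1) by (auto simp: \<alpha>_def)
      have "?noise n (f n) (\<alpha> * ?rel n) \<le> v\<^sup>2 / 8" if "n \<ge> 1" for n
        using noise_le_SUP[OF that, of f \<alpha>] b(2)[OF \<alpha>(1,3)] by (simp add: dist_real_def)
      then show thesis
        using that \<alpha> by blast
    qed
    let ?low = "\<lambda>n \<phi>. \<phi> \<in> low_span (S n) (lam n) (\<psi> n) (1 / \<alpha>) \<and> inner_pi (S n) (\<pi> n) \<phi> \<phi> = 1 \<and>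
        (v \<le> measure_pmf.variance (\<pi> n) (f n) \<longrightarrow>
          measure_pmf.prob (\<pi> n) {w \<in> S n. (\<phi> w)\<^sup>2 < v\<^sup>2 / 4} \<le> 1 / 2)"
    have ex: "\<exists>\<phi>. ?low n \<phi>" if n: "n \<ge> 1" for n
    proof (cases "v \<le> measure_pmf.variance (\<pi> n) (f n)")
      case True
      then show ?thesis
        using spectral_chain.low_frequency_part_of_stable_function[OF sc[OF n], of "f n" v \<alpha>]
          f(1) n v(1) \<alpha>(1) stable[OF n] noise[OF n]
        by (auto simp: boolean_functions_def)
    next
      \<comment> \<open>The finitely many chains where the variance is still small need some unit vector of the span.\<close>
      case False
      have "inner_pi (S n) (\<pi> n) (\<psi> n 1) (\<psi> n 1) = 1"
        using spectral_chain.orthonormal[OF sc[OF n], of 1 1] assms(2)[OF n] by simp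
      then show ?thesis
        using False spectral_chain.psi_1_in_low_span[OF sc[OF n], of "1 / \<alpha>"] \<alpha> by auto
    qed
    have "\<forall>n\<in>{1..}. \<exists>\<phi>. ?low n \<phi>"
      by (intro ballI ex) simp
    from bchoice[OF this] obtain \<phi> where \<phi>: "\<forall>n\<in>{1..}. ?low n (\<phi> n)" ..
    define \<epsilon> where "\<epsilon> = min (v\<^sup>2 / 4) (1 / 4)"
    have "\<forall>\<^sub>F n in sequentially. measure_pmf.prob (\<pi> n) {w \<in> S n. (\<phi> n w)\<^sup>2 < \<epsilon>} < 1 - \<epsilon>"
      using v(2) eventually_ge_at_top[of 1]
    proof eventually_elim
      case (elim n)
      have "measure_pmf.prob (\<pi> n) {w \<in> S n. (\<phi> n w)\<^sup>2 < \<epsilon>}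
          \<le> measure_pmf.prob (\<pi> n) {w \<in> S n. (\<phi> n w)\<^sup>2 < v\<^sup>2 / 4}"
        by (intro measure_pmf.finite_measure_mono) (auto simp: \<epsilon>_def)
      also have "\<dots> \<le> 1 / 2"
        using \<phi> elim by simp
      finally show ?case
        by (simp add: \<epsilon>_def)
    qed
    moreover have "0 < \<epsilon>" "0 < 1 / \<alpha>"
      using v(1) \<alpha> by (auto simp: \<epsilon>_def)
    ultimately show ?B
      using \<phi> by (intro exI[of _ \<epsilon>] exI[of _ "1 / \<alpha>"] exI[of _ \<phi>] conjI) auto
  qed

  show ?A if ?B
  proof -
    obtain \<epsilon> k \<phi> where \<epsilon>: "0 < \<epsilon>" and k: "0 < k"
      and \<phi>: "\<And>n. n \<ge> 1 \<Longrightarrow> \<phi> n \<in> low_span (S n) (lam n) (\<psi> n) k"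
        "\<And>n. n \<ge> 1 \<Longrightarrow> inner_pi (S n) (\<pi> n) (\<phi> n) (\<phi> n) = 1"
      and spread: "\<forall>\<^sub>F n in sequentially. measure_pmf.prob (\<pi> n) {w \<in> S n. (\<phi> n w)\<^sup>2 < \<epsilon>} < 1 - \<epsilon>"
      using \<open>?B\<close> by blast
    define m where "m = \<epsilon> * sqrt \<epsilon>"
    define C where "C = 16 * sqrt (2 * k) / m"
    have m: "0 < m" and C: "0 < C"
      using \<epsilon> k by (simp_all add: m_def C_def)
    let ?stable = "\<lambda>n f. f \<in> S n \<rightarrow> {0, 1} \<and>
        (measure_pmf.prob (\<pi> n) {w \<in> S n. (\<phi> n w)\<^sup>2 < \<epsilon>} < 1 - \<epsilon> \<longrightarrow>
          m\<^sup>2 / 32 \<le> measure_pmf.variance (\<pi> n) f) \<and>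
        (\<forall>j. ?noise n f ((1/16)^j * ?rel n) \<le> C * (1/2)^j)"
    have ex: "\<exists>f. ?stable n f" if n: "n \<ge> 1" for n
    proof (cases "measure_pmf.prob (\<pi> n) {w \<in> S n. (\<phi> n w)\<^sup>2 < \<epsilon>} < 1 - \<epsilon>")
      case True
      then show ?thesis
        using spectral_chain.stable_level_set[OF sc[OF n] \<phi>(1,2)[OF n] \<epsilon> k] noise[OF n]
        by (auto simp: m_def C_def)
    next
      \<comment> \<open>A constant function has no noise, and only finitely many chains are affected.\<close>
      case False
      then show ?thesis
        using C by (intro exI[of _ "\<lambda>_. 0"]) auto
    qed
    have "\<forall>n\<in>{1..}. \<exists>f. ?stable n f"
      by (intro ballI ex) simp
    from bchoice[OF this] obtain f where "\<forall>n\<in>{1..}. ?stable n (f n)" ..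
    then have f: "f n \<in> S n \<rightarrow> {0, 1}"
        "measure_pmf.prob (\<pi> n) {w \<in> S n. (\<phi> n w)\<^sup>2 < \<epsilon>} < 1 - \<epsilon> \<Longrightarrow>
          m\<^sup>2 / 32 \<le> measure_pmf.variance (\<pi> n) (f n)"
        "?noise n (f n) ((1/16)^j * ?rel n) \<le> C * (1/2)^j" if "n \<ge> 1" for n j
      using that by simp_all
    have "boolean_functions S f"
      using f(1) by (simp add: boolean_functions_def)
    moreover have "nondegenerate \<pi> f"
    proof -
      have "\<forall>\<^sub>F n in sequentially. ereal (m\<^sup>2 / 32) \<le> ereal (measure_pmf.variance (\<pi> n) (f n))"
        using spread eventually_ge_at_top[of 1] by eventually_elim (use f(2) in auto)
      then have "ereal (m\<^sup>2 / 32) \<le> liminf (\<lambda>n. ereal (measure_pmf.variance (\<pi> n) (f n)))"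
        by (rule Liminf_bounded)
      moreover have "0 < ereal (m\<^sup>2 / 32)"
        using m by simp
      ultimately show ?thesis
        unfolding nondegenerate_def by (rule less_le_trans[rotated])
    qed
    moreover have "noise_stable M X ?rel f"
      unfolding noise_stable_def
    proof (rule tendstoI)
      fix \<delta> :: real
      assume "0 < \<delta>"
      then obtain j where j: "(1/2)^j < \<delta> / C"
        using C real_arch_pow_inv[of "\<delta> / C" "1/2"] by auto
      have "\<forall>\<^sub>F \<alpha> in at_right 0. \<alpha> \<in> {0<..<(1/16::real)^j}"
        by (intro eventually_at_right_real) simp
      then show "\<forall>\<^sub>F \<alpha> in at_right 0. dist (SUP n\<in>{1..}. ?noise n (f n) (\<alpha> * ?rel n)) 0 < \<delta>"
      proof eventually_elim
        case (elim \<alpha>)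
        have "?noise n (f n) (\<alpha> * ?rel n) \<le> C * (1/2)^j" if n: "n \<ge> 1" for n
        proof -
          have "0 < ?rel n"
            using spectral_chain.lam_1[OF sc[OF n]] by (simp add: relaxation_time_def)
          then have "?noise n (f n) (\<alpha> * ?rel n) \<le> ?noise n (f n) ((1/16)^j * ?rel n)"
            unfolding noise[OF n, symmetric] using elim f(1)[OF n]
            by (intro spectral_chain.noise_mono[OF sc[OF n]] mult_right_mono) auto
          then show ?thesis
            using f(3)[OF n, of j] by linarith
        qed
        then have "(SUP n\<in>{1..}. ?noise n (f n) (\<alpha> * ?rel n)) \<le> C * (1/2)^j"
          by (intro cSUP_least) auto
        moreover have "C * (1/2)^j < \<delta>"
          using j C by (simp add: field_simps)
        moreover have "0 \<le> (SUP n\<in>{1..}. ?noise n (f n) (\<alpha> * ?rel n))"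
          using noise_le_SUP[of 1 f \<alpha>] by (intro order_trans[OF measure_nonneg]) auto
        ultimately show ?case
          by (simp add: dist_real_def)
      qed
    qed
    ultimately show ?A
      by blast
  qed
qed

end
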